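(* Let $s\ge 2$ be an integer and consider the optimal 2nd-order SSP Runge--Kutta method $(A,b)$ with $s$ stages, having SSP coefficient $\mathcal{C}(A,b)=s-1$. For $2\le s\le 4$, the method possesses a unique 2nd-order accurate SSP dense output formula $\overline{b}$ with quadratic polynomials $\overline{b}_j$ and SSP coefficient $\mathcal{C}(A,\overline{b})=s-1$, namely $$\overline{b}_1(\theta):=\theta-\frac{s-1}{s}\theta^2,\qquad \overline{b}_j(\theta):=\frac1s\theta^2\quad(2\le j\le s).$$ For $s\ge 5$, there exists no 2nd-order SSP dense output formula $\overline{b}$ quadratic in $\theta$ with $\mathcal{C}(A,\overline{b})\ge s-1$.
   Context: An $s$-stage Runge--Kutta method $(A,b)$, with $A=(a_{i,j})\in\mathbb{R}^{s\times s}$ and $b\in\mathbb{R}^s$, approximates solutions of $u'=f(u)$ by $y_i=u_n+h\sum_{j=1}^s a_{i,j}f(y_j)$, $u_{n+1}=u_n+h\sum_{j=1}^s b_jf(y_j)$. Its abscissas are $c_i:=\sum_{j=1}^s a_{i,j}$. The optimal 2nd-order SSP Runge--Kutta method with $s\ge2$ stages is the one with $a_{i,j}=\frac{1}{s-1}$ for $1\le j<i\le s$, $a_{i,j}=0$ for $j\ge i$, and $b_j=\frac1s$ for $1\le j\le s$. Thus $c_j=\frac{j-1}{s-1}$, and $(I+(s-1)A)^{-1}$ is the lower bidiagonal matrix with $1$ on the diagonal, $-1$ on the first subdiagonal and zeros elsewhere. A dense output formula for the method is given by a function $\overline{b}=(\overline{b}_1,\dots,\overline{b}_s):[0,1]\to\mathbb{R}^s$,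 via $u_{n+\theta}=u_n+h\sum_{j=1}^s\overline{b}_j(\theta)f(y_j)$. It is 2nd-order (accurate) if for all $\theta\in[0,1]$: $\sum_{j=1}^s\overline{b}_j(\theta)=\theta$ and $\sum_{j=1}^s\overline{b}_j(\theta)c_j=\theta^2/2$. It is quadratic (in $\theta$) if each $\overline{b}_j$ has the form $\overline{b}_j(\theta)=\sum_{k=0}^2\overline{b}_{j,k}\theta^k$ with real coefficients $\overline{b}_{j,k}$ (leading coefficients are allowed to vanish). No continuity condition $\overline{b}_j(1)=b_j$ is imposed. Let $e=(1,\dots,1)^\top\in\mathbb{R}^s$; all matrix/vector inequalities are componentwise. For $r\ge 0$ such that $(I+rA)^{-1}$ exists consider the conditions (i) $A(I+rA)^{-1}\ge 0$ and $rA(I+rA)^{-1}e\le 1$; (ii) $b^\top(I+rA)^{-1}\ge 0$ and $rb^\top(I+rA)^{-1}e\le 1$; (iii) $\overline{b}(\theta)^\top(I+rA)^{-1}\ge 0$ and $r\overline{b}(\theta)^\top(I+rA)^{-1}e\le 1$ for all $0\le\theta\le 1$. $\mathcal{C}(A,b)$ is the supremum of the set of $r\ge 0$ for which $(I+rA)^{-1}$ exists and (i), (ii) hold (and $0$ if this set is empty). $\mathcal{C}(A,\overline{b})$ is the supremum of the set of $r\ge 0$ for which $(I+rA)^{-1}$ exists and (i), (iii) hold (and $0$ if this set is empty). A dense output formula is SSP (strong stability preserving) if $\mathcal{C}(A,\overline{b})>0$. *)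

theory Defs
  imports "Jordan_Normal_Form.Matrix" "HOL-Library.Extended_Real"
begin

text \<open>
  A Runge-Kutta method with \<open>s\<close> stages is a pair of an \<open>s \<times> s\<close> matrix and a vector of
  dimension \<open>s\<close>. Indices start at \<open>0\<close>, so the stages \<open>1, \<dots>, s\<close> are numbered \<open>0, \<dots>, s - 1\<close>.
  The order \<open>\<le>\<close> on matrices and vectors is the componentwise one.
\<close>

definition ones_vec :: "nat \<Rightarrow> real vec" where
  "ones_vec n = vec n (\<lambda>_. 1)"

text \<open>Only meaningful under \<^const>\<open>invertible_mat\<close>, which accompanies every use below.\<close>

definition mat_inv :: "real mat \<Rightarrow> real mat" where
  "mat_inv M = (THE B. inverts_mat M B \<and> inverts_mat B M)"

lemma mat_inv_eqI:
  assumes MB: "inverts_mat M B" and BM: "inverts_mat B M"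
  shows "mat_inv M = B"
  unfolding mat_inv_def
proof (rule the_equality)
  show "inverts_mat M B \<and> inverts_mat B M" using MB BM by blast
next
  fix C assume C: "inverts_mat M C \<and> inverts_mat C M"
  have dims: "dim_col X = dim_row M \<and> dim_row X = dim_col M"
    if "inverts_mat M X" "inverts_mat X M" for X
  proof
    show "dim_col X = dim_row M"
      using arg_cong[OF that(1)[unfolded inverts_mat_def], of dim_col] by simp
    show "dim_row X = dim_col M"
      using arg_cong[OF that(2)[unfolded inverts_mat_def], of dim_col] by simp
  qed
  define n m where "n = dim_row M" and "m = dim_col M"
  have M: "M \<in> carrier_mat n m" unfolding n_def m_def by (rule carrier_matI) simp_all
  have B: "B \<in> carrier_mat m n"
    unfolding n_def m_def by (rule carrier_matI) (use dims[OF MB BM] in simp_all)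
  have C': "C \<in> carrier_mat m n"
    unfolding n_def m_def by (rule carrier_matI) (use dims[of C] C in simp_all)
  have BM': "B * M = 1\<^sub>m m" using BM carrier_matD(1)[OF B] by (simp add: inverts_mat_def)
  have MC': "M * C = 1\<^sub>m n" using C by (simp add: inverts_mat_def n_def)
  have "C = (B * M) * C" unfolding BM' using left_mult_one_mat[OF C'] by simp
  also have "\<dots> = B * (M * C)" by (rule assoc_mult_mat[OF B M C'])
  also have "\<dots> = B" unfolding MC' by (rule right_mult_one_mat[OF B])
  finally show "C = B" .
qed

definition abscissas :: "real mat \<Rightarrow> real vec" where
  "abscissas A = A *\<^sub>v ones_vec (dim_col A)"

definition shifted :: "real mat \<Rightarrow> real \<Rightarrow> real mat" where
  "shifted A r = 1\<^sub>m (dim_row A) + r \<cdot>\<^sub>m A"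

definition ssp_stages :: "real mat \<Rightarrow> real \<Rightarrow> bool" where
  "ssp_stages A r \<longleftrightarrow>
     0\<^sub>m (dim_row A) (dim_row A) \<le> A * mat_inv (shifted A r) \<and>
     r \<cdot>\<^sub>v ((A * mat_inv (shifted A r)) *\<^sub>v ones_vec (dim_row A)) \<le> ones_vec (dim_row A)"

text \<open>The row vector \<open>w\<^sup>T (I + r A)\<^sup>-\<^sup>1\<close> is represented by its transpose.\<close>

definition ssp_weights :: "real mat \<Rightarrow> real \<Rightarrow> real vec \<Rightarrow> bool" where
  "ssp_weights A r w \<longleftrightarrow>
     0\<^sub>v (dim_row A) \<le> transpose_mat (mat_inv (shifted A r)) *\<^sub>v w \<and>
     r * ((transpose_mat (mat_inv (shifted A r)) *\<^sub>v w) \<bullet> ones_vec (dim_row A)) \<le> 1"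

definition sup_or_zero :: "real set \<Rightarrow> ereal" where
  "sup_or_zero R = (if R = {} then 0 else (SUP r\<in>R. ereal r))"

definition ssp_coeff :: "real mat \<Rightarrow> real vec \<Rightarrow> ereal" where
  "ssp_coeff A b =
     sup_or_zero {r. 0 \<le> r \<and> invertible_mat (shifted A r) \<and> ssp_stages A r \<and> ssp_weights A r b}"

definition ssp_coeff_dense :: "real mat \<Rightarrow> (real \<Rightarrow> real vec) \<Rightarrow> ereal" where
  "ssp_coeff_dense A bb =
     sup_or_zero {r. 0 \<le> r \<and> invertible_mat (shifted A r) \<and> ssp_stages A r \<and>
                     (\<forall>\<theta>\<in>{0..1}. ssp_weights A r (bb \<theta>))}"

text \<open>
  A dense output formula is a function on \<open>[0,1]\<close>; it is represented by a total function
  whose values outside \<open>[0,1]\<close> are never inspected.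
\<close>

definition dense_output :: "nat \<Rightarrow> (real \<Rightarrow> real vec) \<Rightarrow> bool" where
  "dense_output s bb \<longleftrightarrow> (\<forall>\<theta>\<in>{0..1}. bb \<theta> \<in> carrier_vec s)"

definition second_order_dense :: "real mat \<Rightarrow> (real \<Rightarrow> real vec) \<Rightarrow> bool" where
  "second_order_dense A bb \<longleftrightarrow>
     (\<forall>\<theta>\<in>{0..1}. (\<Sum>j<dim_row A. bb \<theta> $ j) = \<theta> \<and>
                  (\<Sum>j<dim_row A. bb \<theta> $ j * abscissas A $ j) = \<theta>\<^sup>2 / 2)"

definition quadratic_dense :: "nat \<Rightarrow> (real \<Rightarrow> real vec) \<Rightarrow> bool" where
  "quadratic_dense s bb \<longleftrightarrow>
     (\<exists>\<beta> :: nat \<Rightarrow> nat \<Rightarrow> real. \<forall>j<s. \<forall>\<theta>\<in>{0..1}. bb \<theta> $ j = (\<Sum>k\<le>2. \<beta> j k * \<theta> ^ k))"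

definition ssp_dense :: "real mat \<Rightarrow> (real \<Rightarrow> real vec) \<Rightarrow> bool" where
  "ssp_dense A bb \<longleftrightarrow> ssp_coeff_dense A bb > 0"

definition opt2_A :: "nat \<Rightarrow> real mat" where
  "opt2_A s = mat s s (\<lambda>(i, j). if j < i then 1 / (real s - 1) else 0)"

definition opt2_b :: "nat \<Rightarrow> real vec" where
  "opt2_b s = vec s (\<lambda>_. 1 / real s)"

definition opt2_dense :: "nat \<Rightarrow> real \<Rightarrow> real vec" where
  "opt2_dense s \<theta> =
     vec s (\<lambda>j. if j = 0 then \<theta> - (real s - 1) / real s * \<theta>\<^sup>2 else 1 / real s * \<theta>\<^sup>2)"

definition quadratic_ssp_dense_formula :: "nat \<Rightarrow> (real \<Rightarrow> real vec) \<Rightarrow> bool" where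
  "quadratic_ssp_dense_formula s bb \<longleftrightarrow>
     dense_output s bb \<and> second_order_dense (opt2_A s) bb \<and>
     quadratic_dense s bb \<and> ssp_dense (opt2_A s) bb"

end

theory Submission
  imports Defs "Jordan_Normal_Form.Determinant"
begin

text \<open>
  Put \<open>q = 1 - r / (s - 1)\<close>. The entries of \<open>(I + r A)\<^sup>-\<^sup>1\<close> are polynomials in \<open>q\<close>, and
  the condition on the second stage alone is \<open>q \<ge> 0\<close>, so no coefficient exceeds \<open>s - 1\<close>.
  As the conditions on the weights are closed in \<open>r\<close>, a dense output formula with coefficient
  \<open>s - 1\<close> satisfies them at \<open>q = 0\<close>: its weights \<open>w\<^sub>j(\<theta>)\<close> are nonnegative and decreasing
  in \<open>j\<close>, and \<open>(s - 1) w\<^sub>0(\<theta>) \<le> 1\<close>. At \<open>\<theta> = 1\<close> the order conditions say that the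
  decreasing weights have the mean index of the uniform distribution, which forces
  \<open>w\<^sub>j(1) = 1/s\<close>. For \<open>j > 0\<close> the second order condition gives \<open>w\<^sub>j(\<theta>) = O(\<theta>\<^sup>2)\<close>, so a
  quadratic \<open>w\<^sub>j\<close> is \<open>\<theta>\<^sup>2/s\<close>, and the first order condition determines \<open>w\<^sub>0\<close>. Finally
  \<open>(s - 1) w\<^sub>0\<close> has maximum \<open>s/4\<close>, attained at \<open>\<theta> = s / (2 (s - 1))\<close>.
\<close>

section \<open>The inverse of \<open>I + r A\<close> in closed form\<close>

definition inv_entry :: "real \<Rightarrow> nat \<Rightarrow> nat \<Rightarrow> real" where
  "inv_entry q i j = (if i = j then 1 else if j < i then (q - 1) * q ^ (i - j - 1) else 0)"

text \<open>The terms telescope: \<open>q ^ d + (q - 1) * q ^ d = q ^ Suc d\<close>. As row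
  \<open>i\<close> of \<open>A\<close> is constant on the columns before \<open>i\<close>, these
  partial column sums are, up to the factor \<open>1 / (s - 1)\<close>, the entries of
  \<open>A (I + r A)^-1\<close>.\<close>

lemma sum_inv_entry_column:
  "(\<Sum>k<i. inv_entry q k j) = (if j < i then q ^ (i - j - 1) else 0)"
proof (induction i)
  case 0
  then show ?case by simp
next
  case (Suc i)
  show ?case
  proof (cases "j < i")
    case True
    then obtain d where d: "i = Suc (j + d)" using less_iff_Suc_add by auto
    show ?thesis using Suc by (simp add: inv_entry_def d algebra_simps)
  next
    case False
    then show ?thesis using Suc by (auto simp: inv_entry_def)
  qed
qed

lemma sum_lower_triangle:
  fixes f :: "nat \<Rightarrow> real"
  assumes "i \<le> s"
  shows "(\<Sum>k<s. (if k < i then c else 0) * f k) = c * (\<Sum>k<i. f k)"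
proof -
  have "(\<Sum>k<s. (if k < i then c else 0) * f k) = (\<Sum>k<s. if k \<in> {..<i} then c * f k else 0)"
    by (rule sum.cong) auto
  also have "\<dots> = (\<Sum>k\<in>{..<s} \<inter> {..<i}. c * f k)"
    by (simp add: sum.inter_restrict)
  also have "{..<s} \<inter> {..<i} = {..<i}" using assms by auto
  finally show ?thesis by (simp add: sum_distrib_left)
qed

definition inv_mat :: "nat \<Rightarrow> real \<Rightarrow> real mat" where
  "inv_mat s r = mat s s (\<lambda>(i, j). inv_entry (1 - r / (real s - 1)) i j)"

lemma inv_mat_carrier [simp]: "inv_mat s r \<in> carrier_mat s s"
  by (simp add: inv_mat_def)

lemma opt2_A_carrier [simp]: "opt2_A s \<in> carrier_mat s s"
  by (simp add: opt2_A_def)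

lemma opt2_A_dim [simp]: "dim_row (opt2_A s) = s" "dim_col (opt2_A s) = s"
  by (simp_all add: opt2_A_def)

lemma opt2_A_times_inv_mat:
  "opt2_A s * inv_mat s r =
     mat s s (\<lambda>(i, j). if j < i then 1 / (real s - 1) * (1 - r / (real s - 1)) ^ (i - j - 1) else 0)"
  (is "_ = ?R")
proof (rule eq_matI)
  fix i j assume "i < dim_row ?R" "j < dim_col ?R"
  then have ij: "i < s" "j < s" by auto
  have "(opt2_A s * inv_mat s r) $$ (i, j) =
      (\<Sum>k<s. (if k < i then 1 / (real s - 1) else 0) * inv_entry (1 - r / (real s - 1)) k j)"
    using ij by (simp add: opt2_A_def inv_mat_def scalar_prod_def lessThan_atLeast0)
  also have "\<dots> = 1 / (real s - 1) * (\<Sum>k<i. inv_entry (1 - r / (real s - 1)) k j)"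
    using ij by (intro sum_lower_triangle) simp
  finally show "(opt2_A s * inv_mat s r) $$ (i, j) = ?R $$ (i, j)"
    using ij by (simp add: sum_inv_entry_column)
qed (simp_all add: inv_mat_def)

lemma shifted_carrier: "shifted (opt2_A s) r \<in> carrier_mat s s"
  by (simp add: shifted_def)

text \<open>Below the diagonal the two contributions cancel because
  \<open>q - 1 = - r / (s - 1)\<close>. The inverse thus exists for every real \<open>r\<close>, and
  invertibility never restricts the SSP coefficients.\<close>

lemma shifted_times_inv_mat: "shifted (opt2_A s) r * inv_mat s r = 1\<^sub>m s"
proof -
  have "shifted (opt2_A s) r * inv_mat s r = inv_mat s r + r \<cdot>\<^sub>m (opt2_A s * inv_mat s r)"
    unfolding shifted_def opt2_A_dim
    by (subst add_mult_distrib_mat[of _ s s _ _ s])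
       (simp_all add: mult_smult_assoc_mat[of _ s s _ s] left_mult_one_mat[of _ s s])
  also have "\<dots> = 1\<^sub>m s"
    unfolding opt2_A_times_inv_mat
    by (rule eq_matI) (auto simp: inv_mat_def inv_entry_def)
  finally show ?thesis .
qed

lemma inverts_shifted:
  "inverts_mat (shifted (opt2_A s) r) (inv_mat s r)"
  "inverts_mat (inv_mat s r) (shifted (opt2_A s) r)"
  using shifted_times_inv_mat
    mat_mult_left_right_inverse[OF shifted_carrier inv_mat_carrier shifted_times_inv_mat]
    carrier_matD(1)[OF shifted_carrier] carrier_matD(1)[OF inv_mat_carrier]
  by (simp_all add: inverts_mat_def)

lemma mat_inv_shifted: "mat_inv (shifted (opt2_A s) r) = inv_mat s r"
  using inverts_shifted by (rule mat_inv_eqI)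

lemma invertible_shifted: "invertible_mat (shifted (opt2_A s) r)"
  using inverts_shifted[of s r] carrier_matD[OF shifted_carrier[of s r]]
  unfolding invertible_mat_def by auto

section \<open>The SSP conditions of the method\<close>

lemma ssp_stages_opt2_iff:
  assumes "s \<ge> 2"
  shows "ssp_stages (opt2_A s) r \<longleftrightarrow> r \<le> real s - 1"
proof -
  define N where "N = real s - 1"
  define q where "q = 1 - r / N"
  have N: "N > 0" using assms by (simp add: N_def)
  have row: "r * (\<Sum>j<s. if j < i then 1 / N * q ^ (i - j - 1) else 0) = 1 - q ^ i" if "i < s" for i
  proof -
    have "(\<Sum>j<s. if j < i then 1 / N * q ^ (i - j - 1) else 0)
        = (\<Sum>j<s. (if j < i then 1 / N else 0) * q ^ (i - Suc j))"
      by (rule sum.cong) auto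
    also have "\<dots> = 1 / N * (\<Sum>j<i. q ^ j)"
      using that by (subst sum_lower_triangle) (simp_all add: sum.nat_diff_reindex[of "\<lambda>j. q ^ j"])
    \<comment> \<open>Since \<open>r / N = 1 - q\<close>, the factor in front of the geometric sum
      collapses it to \<open>1 - q ^ i\<close>.\<close>
    finally show ?thesis
      using N by (simp add: one_diff_power_eq q_def)
  qed
  have rows: "(r \<cdot>\<^sub>v ((opt2_A s * inv_mat s r) *\<^sub>v ones_vec s)) $ i = 1 - q ^ i" if "i < s" for i
    using that row[OF that, unfolded q_def N_def]
    by (simp add: opt2_A_times_inv_mat scalar_prod_def ones_vec_def lessThan_atLeast0 q_def N_def)
  have "ssp_stages (opt2_A s) r \<longleftrightarrow>
      (\<forall>i<s. \<forall>j<i. 0 \<le> 1 / N * q ^ (i - j - 1)) \<and> (\<forall>i<s. 1 - q ^ i \<le> 1)"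
    unfolding ssp_stages_def mat_inv_shifted less_eq_vec_def opt2_A_dim
    using rows
    by (auto simp: less_eq_mat_def opt2_A_times_inv_mat ones_vec_def q_def N_def)
  also have "\<dots> \<longleftrightarrow> 0 \<le> q"
  proof
    assume "(\<forall>i<s. \<forall>j<i. 0 \<le> 1 / N * q ^ (i - j - 1)) \<and> (\<forall>i<s. 1 - q ^ i \<le> 1)"
    \<comment> \<open>Index \<open>1\<close> is a stage because \<open>s \<ge> 2\<close>.\<close>
    then have "1 - q ^ 1 \<le> 1" using assms by (metis Suc_1 Suc_le_lessD)
    then show "0 \<le> q" by simp
  qed (use N in auto)
  also have "\<dots> \<longleftrightarrow> r \<le> real s - 1"
    using N by (simp add: q_def N_def field_simps)
  finally show ?thesis .
qed

text \<open>Component \<open>j\<close> of the row vector \<open>w^T (I + r A)^-1\<close>,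
  parametrised by \<open>q\<close> instead of \<open>r\<close>.\<close>

definition inv_weight :: "nat \<Rightarrow> real vec \<Rightarrow> real \<Rightarrow> nat \<Rightarrow> real" where
  "inv_weight s w q j = (\<Sum>i<s. inv_entry q i j * w $ i)"

lemma ssp_weights_opt2_iff:
  assumes "w \<in> carrier_vec s"
  shows "ssp_weights (opt2_A s) r w \<longleftrightarrow>
    (\<forall>j<s. 0 \<le> inv_weight s w (1 - r / (real s - 1)) j) \<and>
    r * (\<Sum>j<s. inv_weight s w (1 - r / (real s - 1)) j) \<le> 1"
proof -
  have "transpose_mat (inv_mat s r) *\<^sub>v w = vec s (inv_weight s w (1 - r / (real s - 1)))"
    using assms
    by (intro eq_vecI)
       (auto simp: inv_weight_def inv_mat_def scalar_prod_def lessThan_atLeast0)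
  then show ?thesis
    unfolding ssp_weights_def mat_inv_shifted opt2_A_dim
    by (auto simp: less_eq_vec_def scalar_prod_def ones_vec_def lessThan_atLeast0)
qed

lemma inv_weight_at_0:
  assumes "j < s"
  shows "inv_weight s w 0 j = w $ j - (if Suc j < s then w $ Suc j else 0)"
proof -
  \<comment> \<open>At \<open>q = 0\<close> the inverse is bidiagonal: the convention
    \<open>0 ^ 0 = 1\<close> leaves \<open>-1\<close> at \<open>i = Suc j\<close>, and the higher
    powers vanish.\<close>
  have "inv_entry 0 i j * w $ i = (if i = j then w $ i else 0) - (if i = Suc j then w $ i else 0)" for i
    by (auto simp: inv_entry_def power_0_left)
  then show ?thesis
    using assms by (simp add: inv_weight_def sum_subtractf)
qed

text \<open>At \<open>r = s - 1\<close> the transformed weights are successive differences of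
  \<open>w\<close>, so their sum telescopes to the first weight.\<close>

lemma ssp_weights_opt2_at_bound:
  assumes "w \<in> carrier_vec s" "s \<ge> 2"
  shows "ssp_weights (opt2_A s) (real s - 1) w \<longleftrightarrow>
    (\<forall>j. Suc j < s \<longrightarrow> w $ Suc j \<le> w $ j) \<and> 0 \<le> w $ (s - 1) \<and> (real s - 1) * w $ 0 \<le> 1"
proof -
  obtain n where n: "s = Suc n" using assms by (cases s) auto
  have "(\<Sum>j<n. inv_weight s w 0 j) = (\<Sum>j<n. w $ j - w $ Suc j)"
    by (rule sum.cong) (auto simp: inv_weight_at_0 n)
  then have "(\<Sum>j<s. inv_weight s w 0 j) = w $ 0"
    by (simp add: n inv_weight_at_0 sum_lessThan_telescope')
  moreover have "(\<forall>j<s. 0 \<le> inv_weight s w 0 j) \<longleftrightarrow>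
      (\<forall>j<n. 0 \<le> inv_weight s w 0 j) \<and> 0 \<le> inv_weight s w 0 n"
    unfolding n by (metis less_Suc_eq)
  moreover have "(\<forall>j<n. 0 \<le> inv_weight s w 0 j) \<longleftrightarrow> (\<forall>j<n. w $ Suc j \<le> w $ j)"
    by (simp add: inv_weight_at_0 n)
  moreover have "inv_weight s w 0 n = w $ n"
    by (simp add: inv_weight_at_0 n)
  moreover have "1 - (real s - 1) / (real s - 1) = 0"
    using assms(2) by simp
  ultimately show ?thesis
    unfolding ssp_weights_opt2_iff[OF assms(1)] by (simp add: n)
qed

lemma closed_ssp_weights_opt2:
  assumes "w \<in> carrier_vec s"
  shows "closed {r. ssp_weights (opt2_A s) r w}"
proof -
  have cont: "continuous_on UNIV (\<lambda>r. inv_weight s w (1 - r / (real s - 1)) j)" for j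
  proof -
    \<comment> \<open>With \<open>inverse\<close> the argument is visibly linear in
      \<open>r\<close>, and no side condition on the denominator arises.\<close>
    have "continuous_on UNIV (\<lambda>r. inv_entry (1 - r * inverse (real s - 1)) i j)" for i
      by (cases "i = j"; cases "j < i") (auto simp: inv_entry_def intro!: continuous_intros)
    then show ?thesis
      unfolding inv_weight_def divide_inverse by (intro continuous_intros)
  qed
  show ?thesis
    unfolding ssp_weights_opt2_iff[OF assms]
    by (intro closed_Collect_conj closed_Collect_all closed_Collect_imp open_Collect_const
              closed_Collect_le continuous_intros cont)
qed

section \<open>Attained suprema, and two facts about sequences and quadratics\<close>

lemma sup_or_zero_eq_maximum:
  assumes "m \<in> R" "\<And>r. r \<in> R \<Longrightarrow> r \<le> m"
  shows "sup_or_zero R = ereal m"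
  using assms by (auto simp: sup_or_zero_def intro!: SUP_eqI)

text \<open>If \<open>m\<close> bounds \<open>R\<close> and the supremum reaches \<open>m\<close>,
  then \<open>R\<close> comes arbitrarily close to \<open>m\<close>, and so does the closed set
  \<open>F\<close>. Positivity of \<open>m\<close> rules out the default value \<open>0\<close> of
  the empty set.\<close>

lemma closed_contains_sup_or_zero:
  assumes "closed F" "R \<subseteq> F" "m > 0" "\<And>r. r \<in> R \<Longrightarrow> r \<le> m" "sup_or_zero R \<ge> ereal m"
  shows "m \<in> F"
proof (rule ccontr)
  assume "m \<notin> F"
  then obtain e where e: "e > 0" "\<And>r. dist r m < e \<Longrightarrow> r \<notin> F"
    using assms(1) by (auto simp: closed_def open_dist)
  have "ereal (m - e) < sup_or_zero R"
    using assms(5) e(1) by (rule_tac less_le_trans[of _ "ereal m"]) auto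
  moreover have "R \<noteq> {}"
    using assms(3,5) by (auto simp: sup_or_zero_def)
  ultimately obtain r where "r \<in> R" "m - e < r"
    by (auto simp: sup_or_zero_def less_SUP_iff)
  then show False
    using e(2)[of r] assms(2,4) by (force simp: dist_real_def)
qed

text \<open>Equality case of Chebyshev's sum inequality. Pairing \<open>j\<close> with
  \<open>N - j\<close> gives terms \<open>(N - 2 j) (x j - x (N - j))\<close>, nonnegative by
  monotonicity, with sum zero by balance. The vanishing term at \<open>j = 0\<close> gives
  \<open>x 0 = x N\<close>, which squeezes everything in between.\<close>

lemma antimono_balanced_imp_const:
  fixes x :: "nat \<Rightarrow> real"
  assumes dec: "\<And>j. j < N \<Longrightarrow> x (Suc j) \<le> x j"
    and bal: "(\<Sum>j\<le>N. real j * x j) = real N / 2 * (\<Sum>j\<le>N. x j)"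
    and j: "j \<le> N"
  shows "x j = x 0"
proof (cases "N = 0")
  case False
  have mono: "x k \<le> x i" if "i \<le> k" "k \<le> N" for i k
    using that
  proof (induction k rule: dec_induct)
    case (step k)
    then show ?case using dec[of k] by simp
  qed simp
  let ?t = "\<lambda>j. (real N - 2 * real j) * (x j - x (N - j))"
  have bal0: "(\<Sum>j\<le>N. (real N - 2 * real j) * x j) = 0"
    using bal by (simp add: algebra_simps sum_subtractf sum_distrib_left)
  \<comment> \<open>The reflection of indices changes the sign of \<open>N - 2 j\<close>.\<close>
  have "(\<Sum>j\<le>N. (real N - 2 * real j) * x (N - j)) = (\<Sum>j\<le>N. - ((real N - 2 * real j) * x j))"
    by (rule sum.reindex_bij_witness[of _ "\<lambda>j. N - j" "\<lambda>j. N - j"])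
       (auto simp: of_nat_diff algebra_simps)
  then have "(\<Sum>j\<le>N. ?t j) = 0"
    using bal0 by (simp add: right_diff_distrib sum_subtractf sum_negf)
  moreover have "?t j \<ge> 0" if "j \<le> N" for j
  proof (cases "2 * j \<le> N")
    case True
    then have "x (N - j) \<le> x j" using that by (intro mono) auto
    with True show ?thesis by (intro mult_nonneg_nonneg) auto
  next
    case False
    then have "x j \<le> x (N - j)" using that by (intro mono) auto
    with False show ?thesis by (intro mult_nonpos_nonpos) auto
  qed
  ultimately have "\<forall>j\<in>{..N}. ?t j = 0"
    by (subst (asm) sum_nonneg_eq_0_iff) auto
  then have "?t 0 = 0" by blast
  then have "x 0 = x N" using False by simp
  then show ?thesis using mono[of 0 j] mono[of j N] j by simp
qed (use j in simp)

text \<open>The value at \<open>0\<close> kills \<open>a\<close>; dividing by \<open>t\<close> then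
  bounds the absolute value of \<open>b\<close> by a multiple of \<open>t\<close>, with
  \<open>t\<close> arbitrarily small.\<close>

lemma quadratic_eq_leading_term:
  fixes a b c C :: real
  assumes bound: "\<And>t. 0 \<le> t \<Longrightarrow> t \<le> 1 \<Longrightarrow> \<bar>a + b * t + c * t\<^sup>2\<bar> \<le> C * t\<^sup>2"
  shows "a = 0 \<and> b = 0"
proof
  show a: "a = 0" using bound[of 0] by simp
  have lin: "\<bar>b\<bar> \<le> (C + \<bar>c\<bar>) * t" if "0 < t" "t \<le> 1" for t
  proof -
    have "\<bar>b\<bar> * t = \<bar>b * t\<bar>" using that by (simp add: abs_mult)
    also have "\<dots> \<le> C * t\<^sup>2 + \<bar>c * t\<^sup>2\<bar>" using bound[of t] that a by linarith
    also have "\<dots> = (C + \<bar>c\<bar>) * t * t"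
      by (simp add: abs_mult power2_eq_square algebra_simps)
    finally show ?thesis using that by (simp add: mult_le_cancel_right)
  qed
  show "b = 0"
  proof (rule ccontr)
    assume b: "b \<noteq> 0"
    define K where "K = C + \<bar>c\<bar>"
    have K: "K \<ge> \<bar>b\<bar>" using lin[of 1] by (simp add: K_def)
    \<comment> \<open>This \<open>t\<close> is at most \<open>1/2\<close> by \<open>K\<close>, and
      is chosen so that the bound becomes half of the left side.\<close>
    have "\<bar>b\<bar> \<le> K * (\<bar>b\<bar> / (2 * K))"
      unfolding K_def by (rule lin) (use b K in \<open>auto simp: K_def field_simps\<close>)
    also have "\<dots> = \<bar>b\<bar> / 2" using b K by auto
    finally show False using b by simp
  qed
qed

section \<open>Order conditions and uniqueness\<close>

lemma abscissas_opt2: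
  assumes "j < s"
  shows "abscissas (opt2_A s) $ j = real j / (real s - 1)"
proof -
  have "abscissas (opt2_A s) $ j = (\<Sum>k<s. (if k < j then 1 / (real s - 1) else 0) * 1)"
    using assms
    by (simp add: abscissas_def opt2_A_def ones_vec_def scalar_prod_def lessThan_atLeast0)
  also have "\<dots> = real j / (real s - 1)"
    using assms by (subst sum_lower_triangle) auto
  finally show ?thesis .
qed

lemma second_order_dense_opt2_iff:
  assumes "s \<ge> 2"
  shows "second_order_dense (opt2_A s) bb \<longleftrightarrow>
    (\<forall>\<theta>\<in>{0..1}. (\<Sum>j<s. bb \<theta> $ j) = \<theta> \<and>
                (\<Sum>j<s. real j * bb \<theta> $ j) = (real s - 1) * \<theta>\<^sup>2 / 2)"
proof -
  have "(\<Sum>j<s. bb \<theta> $ j * abscissas (opt2_A s) $ j) = (\<Sum>j<s. real j * bb \<theta> $ j) / (real s - 1)" for \<theta>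
    by (simp add: abscissas_opt2 sum_divide_distrib mult.commute)
  moreover have "x / (real s - 1) = y / 2 \<longleftrightarrow> x = (real s - 1) * y / 2" for x y
    using assms by (auto simp: field_simps)
  ultimately show ?thesis
    by (simp only: second_order_dense_def opt2_A_dim)
qed

text \<open>The coefficient is only a supremum of admissible \<open>r\<close>. The stage condition
  caps these at \<open>s - 1\<close>, so closedness, used separately for each
  \<open>\<theta>\<close>, yields the condition at \<open>r = s - 1\<close> itself.\<close>

lemma ssp_weights_of_ssp_coeff_dense:
  assumes "s \<ge> 2" "dense_output s bb" "ssp_coeff_dense (opt2_A s) bb \<ge> ereal (real s - 1)"
    and "\<theta> \<in> {0..1}"
  shows "ssp_weights (opt2_A s) (real s - 1) (bb \<theta>)"
proof -
  have "bb \<theta> \<in> carrier_vec s" using assms by (auto simp: dense_output_def)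
  then have "real s - 1 \<in> {r. ssp_weights (opt2_A s) r (bb \<theta>)}"
    by (rule closed_contains_sup_or_zero[OF closed_ssp_weights_opt2 _ _ _
          assms(3)[unfolded ssp_coeff_dense_def]])
       (use assms(1,4) in \<open>auto simp: ssp_stages_opt2_iff\<close>)
  then show ?thesis by simp
qed

text \<open>For \<open>s \<le> 4\<close> this is the uniqueness claim; for \<open>s \<ge> 5\<close>
  it singles out the one candidate that remains to be refuted.\<close>

lemma dense_formula_unique:
  assumes s: "s \<ge> 2"
    and bb: "quadratic_ssp_dense_formula s bb"
    and coeff: "ssp_coeff_dense (opt2_A s) bb \<ge> ereal (real s - 1)"
    and \<theta>: "\<theta> \<in> {0..1}"
  shows "bb \<theta> = opt2_dense s \<theta>"
proof -
  obtain N where N: "s = Suc N" using s by (cases s) auto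
  from bb have dense: "dense_output s bb" and order: "second_order_dense (opt2_A s) bb"
    and quad: "quadratic_dense s bb"
    by (auto simp: quadratic_ssp_dense_formula_def)
  have carrier: "bb t \<in> carrier_vec s" if "t \<in> {0..1}" for t
    using dense that by (auto simp: dense_output_def)
  have sum1: "(\<Sum>j\<le>N. bb t $ j) = t"
    and sum2: "(\<Sum>j\<le>N. real j * bb t $ j) = real N * t\<^sup>2 / 2" if "t \<in> {0..1}" for t
    using order[unfolded second_order_dense_opt2_iff[OF s]] that
    by (auto simp: N lessThan_Suc_atMost simp del: sum.lessThan_Suc)
  have weights: "(\<forall>j<N. bb t $ Suc j \<le> bb t $ j) \<and> 0 \<le> bb t $ N" if "t \<in> {0..1}" for t
    using ssp_weights_of_ssp_coeff_dense[OF s dense coeff that]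
    unfolding ssp_weights_opt2_at_bound[OF carrier[OF that] s] by (auto simp: N)
  have nonneg: "0 \<le> bb t $ j" if "t \<in> {0..1}" "j \<le> N" for t j
    using that(2) by (induction j rule: inc_induct) (use weights[OF that(1)] in force)+
  \<comment> \<open>At \<open>1\<close> the two order sums are \<open>1\<close> and
    \<open>N / 2\<close>, which is exactly the balance hypothesis.\<close>
  have const: "bb 1 $ j = bb 1 $ 0" if "j \<le> N" for j
    by (rule antimono_balanced_imp_const[of N "\<lambda>j. bb 1 $ j"])
       (use weights[of 1] sum1[of 1] sum2[of 1] that in auto)
  have "(\<Sum>j\<le>N. bb 1 $ j) = (\<Sum>j\<le>N. bb 1 $ 0)"
    by (intro sum.cong refl const) simp
  then have "real s * bb 1 $ 0 = 1" using sum1[of 1] by (simp add: N)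
  then have at1: "bb 1 $ j = 1 / real s" if "j \<le> N" for j
    using const[OF that] by (simp add: field_simps N)
  have tail: "bb \<theta> $ j = \<theta>\<^sup>2 / real s" if j: "0 < j" "j \<le> N" for j
  proof -
    obtain \<beta> :: "nat \<Rightarrow> nat \<Rightarrow> real"
      where "\<And>i t. i < s \<Longrightarrow> t \<in> {0..1} \<Longrightarrow> bb t $ i = (\<Sum>k\<le>2. \<beta> i k * t ^ k)"
      using quad unfolding quadratic_dense_def by auto
    then have \<beta>: "bb t $ j = \<beta> j 0 + \<beta> j 1 * t + \<beta> j 2 * t\<^sup>2" if "t \<in> {0..1}" for t
      using that j by (simp add: N numeral_2_eq_2)
    \<comment> \<open>A single nonnegative weight with \<open>j \<ge> 1\<close> is at most the whole
      second order sum, \<open>N * t^2 / 2\<close>.\<close>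
    have "\<bar>\<beta> j 0 + \<beta> j 1 * t + \<beta> j 2 * t\<^sup>2\<bar> \<le> real N / 2 * t\<^sup>2" if "0 \<le> t" "t \<le> 1" for t
    proof -
      have t: "t \<in> {0..1}" using that by simp
      have "bb t $ j \<le> real j * bb t $ j"
        using mult_right_mono[of 1 "real j" "bb t $ j"] nonneg[OF t j(2)] j by simp
      also have "\<dots> \<le> (\<Sum>j\<le>N. real j * bb t $ j)"
        by (rule member_le_sum) (use j nonneg[OF t] in auto)
      finally show ?thesis using sum2[OF t] nonneg[OF t j(2)] \<beta>[OF t] by simp
    qed
    from quadratic_eq_leading_term[OF this] have "\<beta> j 0 = 0" "\<beta> j 1 = 0" by auto
    \<comment> \<open>Only the leading coefficient is left; the value at \<open>1\<close> fixes
      it.\<close>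
    then have "\<beta> j 2 = 1 / real s" "bb \<theta> $ j = \<beta> j 2 * \<theta>\<^sup>2"
      using \<beta>[of 1] \<beta>[OF \<theta>] at1[OF j(2)] by auto
    then show ?thesis by simp
  qed
  have "(\<Sum>j\<le>N. bb \<theta> $ j) = bb \<theta> $ 0 + (\<Sum>j<N. bb \<theta> $ Suc j)"
    unfolding lessThan_Suc_atMost[symmetric] by (rule sum.lessThan_Suc_shift)
  also have "(\<Sum>j<N. bb \<theta> $ Suc j) = (\<Sum>j<N. \<theta>\<^sup>2 / real s)"
    by (rule sum.cong) (use tail in auto)
  finally have head: "bb \<theta> $ 0 = \<theta> - real N / real s * \<theta>\<^sup>2"
    using sum1[OF \<theta>] by simp
  show ?thesis
  proof (rule eq_vecI)
    fix j assume "j < dim_vec (opt2_dense s \<theta>)"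
    then have "j \<le> N" by (simp add: opt2_dense_def N)
    then show "bb \<theta> $ j = opt2_dense s \<theta> $ j"
      using head tail[of j] by (auto simp: opt2_dense_def N)
  qed (use carrier[OF \<theta>] in \<open>simp add: opt2_dense_def\<close>)
qed

section \<open>The candidate formula and the threshold between \<open>s = 4\<close> and
  \<open>s = 5\<close>\<close>

text \<open>Nonnegativity and monotonicity of the weights hold throughout \<open>[0,1]\<close>,
  because \<open>\<theta>^2 \<le> \<theta>\<close> puts the first weight above the equal remaining
  ones. What is left is the bound on the first weight.\<close>

lemma ssp_weights_opt2_dense_iff:
  assumes "s \<ge> 2" "\<theta> \<in> {0..1}"
  shows "ssp_weights (opt2_A s) (real s - 1) (opt2_dense s \<theta>) \<longleftrightarrow>
    (real s - 1) * (\<theta> - (real s - 1) / real s * \<theta>\<^sup>2) \<le> 1"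
proof -
  have "\<theta>\<^sup>2 \<le> \<theta>" using assms(2) by (simp add: power2_eq_square mult_left_le)
  moreover have "\<theta> - (real s - 1) / real s * \<theta>\<^sup>2 = \<theta> - \<theta>\<^sup>2 + 1 / real s * \<theta>\<^sup>2"
    using assms(1) by (simp add: field_simps)
  ultimately have "1 / real s * \<theta>\<^sup>2 \<le> \<theta> - (real s - 1) / real s * \<theta>\<^sup>2" by linarith
  then show ?thesis
    using assms(1) by (subst ssp_weights_opt2_at_bound) (auto simp: opt2_dense_def)
qed

lemma second_order_opt2_dense:
  assumes "s \<ge> 2"
  shows "second_order_dense (opt2_A s) (opt2_dense s)"
proof -
  obtain N where N: "s = Suc N" using assms by (cases s) auto
  have tri: "(\<Sum>j<N. real j + 1) = real N * (real N + 1) / 2"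
    by (induction N) (auto simp: field_simps)
  have "(\<Sum>j<N. (real j + 1) * (\<theta>\<^sup>2 / (real N + 1))) = real N * \<theta>\<^sup>2 / 2" for \<theta> :: real
    unfolding sum_distrib_right[symmetric] tri by (simp add: divide_simps del: of_nat_Suc)
  then show ?thesis
    unfolding second_order_dense_opt2_iff[OF assms]
    by (simp add: N opt2_dense_def sum.lessThan_Suc_shift add.commute del: sum.lessThan_Suc)
qed

lemma quadratic_opt2_dense: "quadratic_dense s (opt2_dense s)"
proof -
  have sum2: "(\<Sum>k\<le>2. f k) = f 0 + f 1 + f 2" for f :: "nat \<Rightarrow> real"
    by (simp add: numeral_2_eq_2)
  show ?thesis
    unfolding quadratic_dense_def sum2
    by (rule exI[of _ "\<lambda>j k. if k = 0 then 0 else if k = 1 then (if j = 0 then 1 else 0)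
          else if j = 0 then - ((real s - 1) / real s) else 1 / real s"])
       (simp add: opt2_dense_def)
qed

theorem theorem6:
  fixes s :: nat
  assumes "s \<ge> 2"
  shows "ssp_coeff (opt2_A s) (opt2_b s) = ereal (real s - 1) \<and>
         (s \<le> 4 \<longrightarrow>
           quadratic_ssp_dense_formula s (opt2_dense s) \<and>
           ssp_coeff_dense (opt2_A s) (opt2_dense s) = ereal (real s - 1) \<and>
           (\<forall>bb. quadratic_ssp_dense_formula s bb \<and>
                 ssp_coeff_dense (opt2_A s) bb = ereal (real s - 1) \<longrightarrow>
                 (\<forall>\<theta>\<in>{0..1}. bb \<theta> = opt2_dense s \<theta>))) \<and>
         (s \<ge> 5 \<longrightarrow>
           \<not> (\<exists>bb. quadratic_ssp_dense_formula s bb \<and>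
                   ssp_coeff_dense (opt2_A s) bb \<ge> ereal (real s - 1)))"
proof (intro conjI impI)
  define N where "N = real s - 1"
  have N: "N \<ge> 1" "real s = N + 1" using assms by (simp_all add: N_def)
  have "ssp_weights (opt2_A s) (real s - 1) (opt2_b s)"
    using assms by (subst ssp_weights_opt2_at_bound) (auto simp: opt2_b_def)
  then show "ssp_coeff (opt2_A s) (opt2_b s) = ereal (real s - 1)"
    unfolding ssp_coeff_def
    by (intro sup_or_zero_eq_maximum)
       (use assms in \<open>auto simp: ssp_stages_opt2_iff invertible_shifted\<close>)
  \<comment> \<open>Completing the square shows the maximum \<open>s / 4\<close>, which is at most
    \<open>1\<close> exactly for \<open>s \<le> 4\<close>.\<close>
  have peak: "N * (t - N / real s * t\<^sup>2) = real s / 4 - (N * t - real s / 2)\<^sup>2 / real s" for t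
    using N by (simp add: field_simps power2_eq_square)
  show coeff: "ssp_coeff_dense (opt2_A s) (opt2_dense s) = ereal (real s - 1)" if "s \<le> 4"
  proof -
    have "ssp_weights (opt2_A s) (real s - 1) (opt2_dense s \<theta>)" if "\<theta> \<in> {0..1}" for \<theta>
    proof -
      have "0 \<le> (N * \<theta> - real s / 2)\<^sup>2 / real s" by simp
      then have "N * (\<theta> - N / real s * \<theta>\<^sup>2) \<le> 1"
        unfolding peak using \<open>s \<le> 4\<close> by linarith
      then show ?thesis
        unfolding ssp_weights_opt2_dense_iff[OF assms that] by (simp add: N_def)
    qed
    then show ?thesis
      unfolding ssp_coeff_dense_def
      by (intro sup_or_zero_eq_maximum)
         (use assms in \<open>auto simp: ssp_stages_opt2_iff invertible_shifted\<close>)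
  qed
  show "quadratic_ssp_dense_formula s (opt2_dense s)" if "s \<le> 4"
    unfolding quadratic_ssp_dense_formula_def ssp_dense_def coeff[OF that]
    using assms second_order_opt2_dense quadratic_opt2_dense
    by (auto simp: dense_output_def opt2_dense_def)
  show "\<forall>bb. quadratic_ssp_dense_formula s bb \<and>
             ssp_coeff_dense (opt2_A s) bb = ereal (real s - 1) \<longrightarrow>
             (\<forall>\<theta>\<in>{0..1}. bb \<theta> = opt2_dense s \<theta>)"
    using dense_formula_unique[OF assms] by auto
  show "\<not> (\<exists>bb. quadratic_ssp_dense_formula s bb \<and>
                ssp_coeff_dense (opt2_A s) bb \<ge> ereal (real s - 1))" if "s \<ge> 5"
  proof
    assume "\<exists>bb. quadratic_ssp_dense_formula s bb \<and>
                 ssp_coeff_dense (opt2_A s) bb \<ge> ereal (real s - 1)"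
    then obtain bb where bb: "quadratic_ssp_dense_formula s bb"
      and c: "ssp_coeff_dense (opt2_A s) bb \<ge> ereal (real s - 1)" by auto
    \<comment> \<open>The zero of the square in \<open>peak\<close>; it lies in \<open>[0,1]\<close>
      since \<open>s = N + 1\<close> and \<open>N \<ge> 1\<close>.\<close>
    define t where "t = real s / (2 * N)"
    have t: "t \<in> {0..1}" using N by (auto simp: t_def)
    have "ssp_weights (opt2_A s) (real s - 1) (bb t)"
      using bb by (intro ssp_weights_of_ssp_coeff_dense assms c t)
                  (auto simp: quadratic_ssp_dense_formula_def)
    then have "N * (t - N / real s * t\<^sup>2) \<le> 1"
      unfolding dense_formula_unique[OF assms bb c t] ssp_weights_opt2_dense_iff[OF assms t]
      by (simp add: N_def)
    moreover have "N * t = real s / 2" using N by (simp add: t_def)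
    ultimately have "real s / 4 \<le> 1" unfolding peak by simp
    then show False using that by simp
  qed
qed

end
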